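(* The inequality $\min(c(G),c(G_{\min}))\le c(\mathcal{G})$ does not hold in general: there exists a periodic graph $\mathcal{G}$ with footprint $G$ such that $c(\mathcal{G})<\min(c(G),c(G_{\min}))$.
   Context: All graphs are finite, undirected and reflexive. A periodic graph with period $p\ge1$ is a sequence $\mathcal{G}=(G_0,\dots,G_{p-1})$ of graphs $G_i=(V,E_i)$ on a common vertex set, extended by $G_{i+p}=G_i$; its footprint is $G=(V,\bigcup_iE_i)$, assumed connected. Cops and Robber on a periodic graph with $k$ cops (perfect information): cops choose starting vertices, then the robber; in each round $t=0,1,\dots$ each cop moves to a vertex of $N_{G_{t\bmod p}}[\text{its position}]$, then the robber likewise; the cops win if a cop ever moves onto the robber's vertex. The cop number $c(\cdot)$ is the least $k$ such that $k$ cops have a winning strategy; a static graph is a periodic graph of period $1$. $c(G_{\min})=\min_{0\le i\le p-1}c(G_i)$. *)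

theory Defs
  imports Main
begin

definition reflexive_graph :: "'a set \<Rightarrow> 'a rel \<Rightarrow> bool" where
  "reflexive_graph V E \<longleftrightarrow> finite V \<and> E \<subseteq> V \<times> V \<and> refl_on V E \<and> sym E"

definition connected_graph :: "'a set \<Rightarrow> 'a rel \<Rightarrow> bool" where
  "connected_graph V E \<longleftrightarrow> V \<noteq> {} \<and> (\<forall>u\<in>V. \<forall>v\<in>V. (u, v) \<in> E\<^sup>*)"

definition footprint :: "nat \<Rightarrow> (nat \<Rightarrow> 'a rel) \<Rightarrow> 'a rel" where
  "footprint p E = (\<Union>i<p. E i)"

text \<open>
  A periodic graph is given by its vertex set, its period \<open>p\<close> and the edge relations
  \<open>E 0, \<dots>, E (p - 1)\<close>. The values \<open>E i\<close> for \<open>i \<ge> p\<close> are irrelevant: the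
  periodic extension is always accessed as \<open>E (t mod p)\<close>.
\<close>

definition periodic_graph :: "'a set \<Rightarrow> nat \<Rightarrow> (nat \<Rightarrow> 'a rel) \<Rightarrow> bool" where
  "periodic_graph V p E \<longleftrightarrow>
     1 \<le> p \<and> (\<forall>i<p. reflexive_graph V (E i)) \<and> connected_graph V (footprint p E)"

text \<open>
  \<open>r t\<close> is the robber's vertex at the beginning of round \<open>t\<close>. Since the graphs are
  reflexive, the closed neighbourhood of \<open>v\<close> in \<open>E i\<close> is \<open>{w. (v, w) \<in> E i}\<close>, and
  staying put is always possible. Hence every partial play of the robber extends to an
  infinite walk, and it does no harm to let walks continue after a capture.
\<close>

definition robber_walk :: "'a set \<Rightarrow> nat \<Rightarrow> (nat \<Rightarrow> 'a rel) \<Rightarrow> (nat \<Rightarrow> 'a) \<Rightarrow> bool" where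
  "robber_walk V p E r \<longleftrightarrow> r 0 \<in> V \<and> (\<forall>t. (r t, r (Suc t)) \<in> E (t mod p))"

text \<open>
  A strategy \<open>\<sigma>\<close> of the cops maps the robber's history and the index of a cop to a vertex:
  \<open>\<sigma> [] i\<close> is the starting vertex of cop \<open>i\<close>, and \<open>\<sigma> [r 0, \<dots>, r t] i\<close> is its vertex
  after the cops' move in round \<open>t\<close>. The earlier positions of the cops are determined by
  \<open>\<sigma>\<close> and the robber's history, so they need not be passed as arguments.
\<close>

definition cop_strategy ::
  "'a set \<Rightarrow> nat \<Rightarrow> (nat \<Rightarrow> 'a rel) \<Rightarrow> nat \<Rightarrow> ('a list \<Rightarrow> nat \<Rightarrow> 'a) \<Rightarrow> bool" where
  "cop_strategy V p E k \<sigma> \<longleftrightarrow>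
     (\<forall>i<k. \<sigma> [] i \<in> V) \<and>
     (\<forall>r. robber_walk V p E r \<longrightarrow>
        (\<forall>t. \<forall>i<k. (\<sigma> (map r [0..<t]) i, \<sigma> (map r [0..<Suc t]) i) \<in> E (t mod p)))"

definition winning_strategy ::
  "'a set \<Rightarrow> nat \<Rightarrow> (nat \<Rightarrow> 'a rel) \<Rightarrow> nat \<Rightarrow> ('a list \<Rightarrow> nat \<Rightarrow> 'a) \<Rightarrow> bool" where
  "winning_strategy V p E k \<sigma> \<longleftrightarrow>
     cop_strategy V p E k \<sigma> \<and>
     (\<forall>r. robber_walk V p E r \<longrightarrow> (\<exists>t. \<exists>i<k. \<sigma> (map r [0..<Suc t]) i = r t))"

definition cops_win :: "'a set \<Rightarrow> nat \<Rightarrow> (nat \<Rightarrow> 'a rel) \<Rightarrow> nat \<Rightarrow> bool" where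
  "cops_win V p E k \<longleftrightarrow> (\<exists>\<sigma>. winning_strategy V p E k \<sigma>)"

definition cop_number :: "'a set \<Rightarrow> nat \<Rightarrow> (nat \<Rightarrow> 'a rel) \<Rightarrow> nat" where
  "cop_number V p E = (LEAST k. cops_win V p E k)"

definition static_cop_number :: "'a set \<Rightarrow> 'a rel \<Rightarrow> nat" where
  "static_cop_number V E = cop_number V 1 (\<lambda>_. E)"

definition min_snapshot_cop_number :: "'a set \<Rightarrow> nat \<Rightarrow> (nat \<Rightarrow> 'a rel) \<Rightarrow> nat" where
  "min_snapshot_cop_number V p E = Min ((\<lambda>i. static_cop_number V (E i)) ` {..<p})"

text \<open>
  One cop per vertex always suffices, so the \<open>LEAST\<close> in \<^const>\<open>cop_number\<close> is
  well defined; this covers static graphs too, and disconnected snapshots.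
\<close>

lemma cops_win_card:
  assumes p: "1 \<le> p" and g: "\<forall>i<p. reflexive_graph V (E i)"
  shows "cops_win V p E (card V)"
proof -
  have fin: "finite V"
    using p g unfolding reflexive_graph_def by auto
  have refl: "(v, v) \<in> E (t mod p)" if "v \<in> V" for v t
    using p g that unfolding reflexive_graph_def refl_on_def by simp
  obtain f where f: "bij_betw f {0..<card V} V"
    using ex_bij_betw_nat_finite[OF fin] by blast
  have fV: "f i \<in> V" if "i < card V" for i
    using f that by (auto simp: bij_betw_def)
  have "\<exists>i<card V. f i = r 0" if "robber_walk V p E r" for r
  proof -
    have "r 0 \<in> f ` {0..<card V}"
      using f that by (simp add: bij_betw_def robber_walk_def)
    then show ?thesis by force
  qed
  then have "winning_strategy V p E (card V) (\<lambda>_. f)"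
    unfolding winning_strategy_def cop_strategy_def using fV refl by blast
  then show ?thesis
    unfolding cops_win_def by blast
qed

end

theory Submission
  imports Defs
begin

text \<open>
  The footprint is the 4-cycle, and each of the three snapshots is a disconnected part of it, so
  that each of these static graphs needs two cops. On the periodic graph one cop starting at
  \<open>0\<close> suffices: in round 0 only the edge \<open>01\<close> is present, so a robber starting
  at \<open>2\<close> or \<open>3\<close> is stuck, while the cop goes to \<open>1\<close> or stays at \<open>0\<close> in order to
  capture him along \<open>12\<close> or \<open>03\<close> in round 1. The last snapshot only serves to
  close the cycle in the footprint.
\<close>

text \<open>\<open>S\<close> is an invariant of pairs (cop, robber) at the start of a round: no cop
  move captures, and each can be answered by a robber move back into \<open>S\<close>. The bound
  \<open>k \<le> 1\<close> includes the game without cops, where nonemptiness of \<open>V\<close>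
  gives the robber a start.\<close>

lemma not_cops_win_if_safe:
  assumes g: "reflexive_graph V E" and "k \<le> 1"
    and start: "\<And>c. c \<in> V \<Longrightarrow> \<exists>r\<in>V. (c, r) \<in> S"
    and safe: "\<And>c r c'. (c, r) \<in> S \<Longrightarrow> (c, c') \<in> E \<Longrightarrow> c' \<noteq> r"
    and step: "\<And>c r c'. (c, r) \<in> S \<Longrightarrow> (c, c') \<in> E \<Longrightarrow> \<exists>r'. (r, r') \<in> E \<and> (c', r') \<in> S"
    and "V \<noteq> {}"
  shows "\<not> cops_win V 1 (\<lambda>_. E) k"
proof
  assume "cops_win V 1 (\<lambda>_. E) k"
  then obtain \<sigma> where \<sigma>: "winning_strategy V 1 (\<lambda>_. E) k \<sigma>"
    unfolding cops_win_def by blast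
  have EV: "x \<in> V \<and> y \<in> V" if "(x, y) \<in> E" for x y
    using g that unfolding reflexive_graph_def by blast
  have refl: "(x, x) \<in> E" if "x \<in> V" for x
    using g that unfolding reflexive_graph_def refl_on_def by blast
  obtain r0 where r0: "r0 \<in> V" "0 < k \<Longrightarrow> (\<sigma> [] 0, r0) \<in> S"
  proof (cases "0 < k")
    case True
    then have "\<sigma> [] 0 \<in> V"
      using \<sigma> unfolding winning_strategy_def cop_strategy_def by blast
    then show ?thesis using start that by blast
  next
    case False
    then show ?thesis using \<open>V \<noteq> {}\<close> that by blast
  qed
  \<comment> \<open>Staying put as the default makes the robber's play a walk for any \<open>\<sigma>\<close>. This is needed before
      the legality of the cop's moves, which is only guaranteed against walks, can be used.\<close>
  define nxt where "nxt r c = (if \<exists>r'. (r, r') \<in> E \<and> (c, r') \<in> S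
      then SOME r'. (r, r') \<in> E \<and> (c, r') \<in> S else r)" for r c
  have nxt: "(r, nxt r c) \<in> E \<and> (c, nxt r c) \<in> S" if "\<exists>r'. (r, r') \<in> E \<and> (c, r') \<in> S" for r c
    using someI_ex[OF that] that unfolding nxt_def by simp
  have nxt_E: "(r, nxt r c) \<in> E" if "r \<in> V" for r c
  proof (cases "\<exists>r'. (r, r') \<in> E \<and> (c, r') \<in> S")
    case True
    then show ?thesis using nxt by blast
  next
    case False
    then show ?thesis using refl[OF that] by (auto simp: nxt_def)
  qed
  \<comment> \<open>The recursion builds the history \<open>[r 0, ..., r t]\<close>, since
    \<open>\<sigma>\<close> reads all of it. Each new vertex answers the cop's move in the same
    round.\<close>
  define hist where
    "hist = rec_nat [r0] (\<lambda>_ h. h @ [nxt (last h) (\<sigma> h 0)])"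
  define r where "r t = last (hist t)" for t
  have hist_simps: "hist 0 = [r0]" "hist (Suc t) = hist t @ [nxt (r t) (\<sigma> (hist t) 0)]" for t
    by (simp_all add: hist_def r_def)
  have r_simps: "r 0 = r0" "r (Suc t) = nxt (r t) (\<sigma> (hist t) 0)" for t
    using hist_simps by (simp_all add: r_def)
  have hist: "map r [0..<Suc t] = hist t" for t
    by (induction t) (simp_all add: hist_simps r_simps)
  have "r t \<in> V" for t
  proof (induction t)
    case 0
    then show ?case using r0 r_simps(1) by simp
  next
    case (Suc t)
    then show ?case unfolding r_simps(2) using nxt_E EV by blast
  qed
  then have walk: "robber_walk V 1 (\<lambda>_. E) r"
    using nxt_E r0(1) by (simp add: robber_walk_def r_simps)
  from \<sigma> have legal: "\<And>r t i. robber_walk V 1 (\<lambda>_. E) r \<Longrightarrow> i < k \<Longrightarrow>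
      (\<sigma> (map r [0..<t]) i, \<sigma> (map r [0..<Suc t]) i) \<in> E"
    and wins: "\<And>r. robber_walk V 1 (\<lambda>_. E) r \<Longrightarrow>
      \<exists>t. \<exists>i<k. \<sigma> (map r [0..<Suc t]) i = r t"
    unfolding winning_strategy_def cop_strategy_def by simp_all
  obtain t i where ti: "i < k" "\<sigma> (hist t) i = r t"
    using wins[OF walk] unfolding hist by blast
  then have i: "i = 0" and "0 < k" using \<open>k \<le> 1\<close> by auto
  have move: "(\<sigma> (map r [0..<t]) 0, \<sigma> (hist t) 0) \<in> E" for t
    using legal[OF walk \<open>0 < k\<close>] unfolding hist .
  \<comment> \<open>The history stops before \<open>r t\<close>: this is the cop's position before
    its move in round \<open>t\<close>.\<close>
  have inv: "(\<sigma> (map r [0..<t]) 0, r t) \<in> S" for t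
  proof (induction t)
    case 0
    then show ?case using r0 \<open>0 < k\<close> r_simps by simp
  next
    case (Suc t)
    then show ?case
      using nxt[OF step[OF Suc move]] unfolding hist r_simps by blast
  qed
  show False using safe[OF inv move] ti i by blast
qed

text \<open>As \<open>card V\<close> cops win, the least number is attained, so a cop number of at
  most 1 would be a winning number that the invariant \<open>S\<close> rules out.\<close>

lemma static_cop_number_gt_1_if_safe:
  assumes g: "reflexive_graph V E"
    and "\<And>c. c \<in> V \<Longrightarrow> \<exists>r\<in>V. (c, r) \<in> S"
    and "\<And>c r c'. (c, r) \<in> S \<Longrightarrow> (c, c') \<in> E \<Longrightarrow> c' \<noteq> r"
    and "\<And>c r c'. (c, r) \<in> S \<Longrightarrow> (c, c') \<in> E \<Longrightarrow> \<exists>r'. (r, r') \<in> E \<and> (c', r') \<in> S"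
    and "V \<noteq> {}"
  shows "1 < static_cop_number V E"
proof -
  have "cops_win V 1 (\<lambda>_. E) (card V)"
    by (rule cops_win_card) (use g in auto)
  then have win: "cops_win V 1 (\<lambda>_. E) (static_cop_number V E)"
    unfolding static_cop_number_def cop_number_def
    by (rule LeastI[where P = "cops_win V 1 (\<lambda>_. E)"])
  show ?thesis
  proof (rule ccontr)
    assume "\<not> ?thesis"
    then have le: "static_cop_number V E \<le> 1" by simp
    have "\<not> cops_win V 1 (\<lambda>_. E) (static_cop_number V E)"
      by (rule not_cops_win_if_safe[OF g le, where S = S]; fact assms)
    with win show False by contradiction
  qed
qed

text \<open>The robber starts on the side of \<open>X\<close> that the cop is not on and stays put.
  By symmetry of \<open>E\<close>, the cop cannot cross in either direction.\<close>

lemma static_cop_number_gt_1_if_disconnected: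
  assumes g: "reflexive_graph V E" and X: "E `` X \<subseteq> X" "u \<in> V" "u \<in> X" "v \<in> V" "v \<notin> X"
  shows "1 < static_cop_number V E"
proof (rule static_cop_number_gt_1_if_safe[OF g,
      where S = "{(c, r). r \<in> V \<and> (c \<in> X \<longleftrightarrow> r \<notin> X)}"])
  have X_iff: "x \<in> X \<longleftrightarrow> y \<in> X" if "(x, y) \<in> E" for x y
    using g X(1) that unfolding reflexive_graph_def sym_def by blast
  show "\<exists>r\<in>V. (c, r) \<in> {(c, r). r \<in> V \<and> (c \<in> X \<longleftrightarrow> r \<notin> X)}" for c
    using X by auto
  show "c' \<noteq> r" if "(c, r) \<in> {(c, r). r \<in> V \<and> (c \<in> X \<longleftrightarrow> r \<notin> X)}" "(c, c') \<in> E" for c r c'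
    using X_iff that by auto
  show "\<exists>r'. (r, r') \<in> E \<and> (c', r') \<in> {(c, r). r \<in> V \<and> (c \<in> X \<longleftrightarrow> r \<notin> X)}"
    if "(c, r) \<in> {(c, r). r \<in> V \<and> (c \<in> X \<longleftrightarrow> r \<notin> X)}" "(c, c') \<in> E" for c r c'
    using X_iff g that unfolding reflexive_graph_def refl_on_def by blast
qed (use X in auto)

definition ex_verts :: "nat set" where
  "ex_verts = {0, 1, 2, 3}"

definition ex_edges :: "nat \<Rightarrow> nat rel" where
  "ex_edges i = Id_on ex_verts \<union>
     (if i = 0 then {(0, 1), (1, 0)}
      else if i = 1 then {(0, 3), (3, 0), (1, 2), (2, 1)}
      else {(2, 3), (3, 2)})"

lemma reflexive_ex_edges: "reflexive_graph ex_verts (ex_edges i)"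
  unfolding reflexive_graph_def refl_on_def sym_def ex_edges_def
  by (auto simp: ex_verts_def)

lemma footprint_ex_edges:
  "footprint 3 ex_edges = Id_on ex_verts \<union>
     {(0, 1), (1, 0), (1, 2), (2, 1), (2, 3), (3, 2), (0, 3), (3, 0)}"
proof -
  have "{..<3} = {0, 1, 2 :: nat}" by auto
  then show ?thesis by (auto simp: footprint_def ex_edges_def)
qed

lemma reflexive_footprint_ex: "reflexive_graph ex_verts (footprint 3 ex_edges)"
  unfolding reflexive_graph_def refl_on_def sym_def footprint_ex_edges
  by (auto simp: ex_verts_def)

lemma periodic_ex: "periodic_graph ex_verts 3 ex_edges"
proof -
  let ?F = "footprint 3 ex_edges"
  have F: "(0, 1) \<in> ?F" "(1, 0) \<in> ?F" "(1, 2) \<in> ?F" "(2, 1) \<in> ?F" "(0, 3) \<in> ?F" "(3, 0) \<in> ?F"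
    by (auto simp: footprint_ex_edges)
  have "(0, v) \<in> ?F\<^sup>*" "(v, 0) \<in> ?F\<^sup>*" if "v \<in> ex_verts" for v
    using F that unfolding ex_verts_def
    by (auto intro: rtrancl_trans[OF r_into_rtrancl r_into_rtrancl])
  then have "(u, v) \<in> ?F\<^sup>*" if "u \<in> ex_verts" "v \<in> ex_verts" for u v
    using that rtrancl_trans by metis
  then have "connected_graph ex_verts ?F"
    unfolding connected_graph_def by (auto simp: ex_verts_def)
  then show ?thesis
    using reflexive_ex_edges by (simp add: periodic_graph_def)
qed

text \<open>Only the robber's starting vertex \<open>x\<close> matters: the cop first goes to
  whichever of 0 and 1 equals \<open>x\<close> or is joined to it in round 1, then moves to
  \<open>x\<close> and waits there.\<close>

definition ex_strategy :: "nat list \<Rightarrow> nat \<Rightarrow> nat" where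
  "ex_strategy h i = (case h of [] \<Rightarrow> 0
     | x # ys \<Rightarrow> if ys = [] then (if x = 1 \<or> x = 2 then 1 else 0) else x)"

lemma cops_win_ex: "cops_win ex_verts 3 ex_edges 1"
proof -
  have strat: "ex_strategy (map r [0..<0]) i = 0"
    "ex_strategy (map r [0..<Suc 0]) i = (if r 0 = 1 \<or> r 0 = 2 then 1 else 0)"
    "ex_strategy (map r [0..<Suc (Suc t)]) i = r 0" for r t i
    by (simp_all add: ex_strategy_def upt_conv_Cons del: upt_Suc)
  have legal: "(ex_strategy (map r [0..<t]) i, ex_strategy (map r [0..<Suc t]) i) \<in> ex_edges (t mod 3)"
    if "robber_walk ex_verts 3 ex_edges r" for r t i
  proof -
    have r0: "r 0 \<in> ex_verts" using that by (simp add: robber_walk_def)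
    consider "t = 0" | "t = Suc 0" | s where "t = Suc (Suc s)"
      by (metis not0_implies_Suc)
    then show ?thesis
    proof cases
      case 1
      then show ?thesis by (simp only: strat) (auto simp: ex_edges_def ex_verts_def)
    next
      case 2
      then show ?thesis
        using r0 by (simp only: strat) (auto simp: ex_edges_def ex_verts_def)
    next
      case 3
      then show ?thesis
        using r0 by (simp only: strat) (auto simp: ex_edges_def)
    qed
  qed
  have wins: "\<exists>t. ex_strategy (map r [0..<Suc t]) 0 = r t"
    if "robber_walk ex_verts 3 ex_edges r" for r
  proof (cases "r 0 = 0 \<or> r 0 = 1")
    case True
    then have "ex_strategy (map r [0..<Suc 0]) 0 = r 0" using strat(2)[of r 0] by auto
    then show ?thesis by blast
  next
    case False
    have "(r 0, r (Suc 0)) \<in> ex_edges (0 mod 3)"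
      using that unfolding robber_walk_def by blast
    then have "r (Suc 0) = r 0"
      using False by (auto simp: ex_edges_def)
    \<comment> \<open>The cop reaches \<open>r 0\<close> in round 1, before the robber can leave
      it.\<close>
    then show ?thesis using strat(3)[of r 0 0] by (intro exI[of _ "Suc 0"]) (simp only:)
  qed
  have start: "ex_strategy [] i \<in> ex_verts" for i
    by (simp add: ex_strategy_def ex_verts_def)
  have "winning_strategy ex_verts 3 ex_edges 1 ex_strategy"
    unfolding winning_strategy_def cop_strategy_def
  proof (intro conjI allI impI)
    fix r assume "robber_walk ex_verts 3 ex_edges r"
    then show "\<exists>t. \<exists>i<1. ex_strategy (map r [0..<Suc t]) i = r t"
      using wins zero_less_one by blast
  qed (rule start, erule legal)
  then show ?thesis unfolding cops_win_def by blast
qed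

text \<open>On the 4-cycle the robber always returns to the vertex opposite the cop;
  \<open>S\<close> consists of the antipodal pairs.\<close>

lemma static_cop_number_footprint_ex: "1 < static_cop_number ex_verts (footprint 3 ex_edges)"
  by (rule static_cop_number_gt_1_if_safe[OF reflexive_footprint_ex,
        where S = "{(0, 2), (1, 3), (2, 0), (3, 1)}"])
    (auto simp: footprint_ex_edges ex_verts_def)

lemma static_cop_number_ex_edges: "1 < static_cop_number ex_verts (ex_edges i)"
proof -
  \<comment> \<open>A union of components that contains 0 but not 2. Snapshot 1 joins 0 to 3, so it
    needs a different cut from the others.\<close>
  define X :: "nat set" where
    "X = (if i = 1 then {0, 3} else {0, 1})"
  show ?thesis
    by (rule static_cop_number_gt_1_if_disconnected[OF reflexive_ex_edges,
          where X = X and u = 0 and v = 2])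
      (auto simp: X_def ex_edges_def ex_verts_def)
qed

theorem theorem5:
  "\<exists>(V :: nat set) (p :: nat) (E :: nat \<Rightarrow> nat rel).
     periodic_graph V p E \<and>
     cop_number V p E <
       min (static_cop_number V (footprint p E)) (min_snapshot_cop_number V p E)"
proof (intro exI conjI)
  show "periodic_graph ex_verts 3 ex_edges" by (rule periodic_ex)
  have "cop_number ex_verts 3 ex_edges \<le> 1"
    unfolding cop_number_def using cops_win_ex by (rule Least_le)
  moreover have "1 < min_snapshot_cop_number ex_verts 3 ex_edges"
    unfolding min_snapshot_cop_number_def
    by (subst Min_gr_iff) (use static_cop_number_ex_edges in \<open>auto simp: lessThan_empty_iff\<close>)
  ultimately show "cop_number ex_verts 3 ex_edges <
      min (static_cop_number ex_verts (footprint 3 ex_edges))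
        (min_snapshot_cop_number ex_verts 3 ex_edges)"
    using static_cop_number_footprint_ex by linarith
qed

end
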